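(* Let $k$ be a commutative ring, $A$ a commutative $k$-algebra, and $L$ a Lie--Rinehart algebra over $A/k$. Then there is a unique Poisson structure $\{-,-\}$ on the divided power algebra $\Gamma_A L$ such that: (i) $\{a,a'\}=0$ for all $a,a'\in A$; (ii) $\{\gamma_m(\lambda),a\}=\lambda(a)\,\gamma_{m-1}(\lambda)$ for all $\lambda\in L$, all $a\in A$ and all $m\geq1$; (iii) $\{\gamma_m(\lambda),\gamma_n(\lambda')\}=\gamma_{m-1}(\lambda)\,\gamma_{n-1}(\lambda')\,\gamma_1([\lambda,\lambda'])$ for all $\lambda,\lambda'\in L$ and all $m,n\geq1$. Moreover, $\{-,-\}$ is graded of degree $-1$.
   Context: A Lie--Rinehart algebra $L$ over $A/k$ is a left $A$-module that is also a $k$-Lie algebra, endowed with an anchor map $\varrho:L\to \mathrm{Der}_k(A)$ which is $A$-linear and a map of $k$-Lie algebras, such that $[\lambda,a\lambda']=a[\lambda,\lambda']+\varrho(\lambda)(a)\lambda'$ for all $\lambda,\lambda'\in L$, $a\in A$. One writes $\lambda(a)$ for $\varrho(\lambda)(a)$. For an $A$-module $M$, the divided power algebra $\Gamma_A M=\bigoplus_{n\geq0}\Gamma^n_A M$ with maps $\gamma_n:M\to\Gamma^n_A M$ ($n\geq 0$) is the quotient of the polynomial algebra $A[\{x_{\lambda,n}\}_{\lambda\in M,n\geq0}]$ (graded with $A$ in degree $0$ and $x_{\lambda,n}$ in degree $n$) by the homogeneous ideal generated by: $x_{\lambda,0}-1$; $x_{a\lambda,m}-a^mx_{\lambda,m}$;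 $x_{\lambda,m}x_{\lambda,n}-\binom{m+n}{m}x_{\lambda,m+n}$; $x_{\lambda+\lambda',m}-\sum_{i+j=m}x_{\lambda,i}x_{\lambda',j}$ (for $\lambda,\lambda'\in M$, $a\in A$, $m,n\geq0$); $\gamma_n(\lambda)$ is the class of $x_{\lambda,n}$. One has $\Gamma^0_AM=A$ and $\Gamma^1_AM=M$. A Poisson structure on a commutative $k$-algebra $R$ is a $k$-bilinear map $\{-,-\}:R\times R\to R$ which is a derivation in each argument, skew-symmetric ($\{r,r\}=0$ for all $r$), and satisfies the Jacobi identity. It is graded of degree $-1$ if $\{R_d,R_e\}\subseteq R_{d+e-1}$ for all degrees $d,e$. *)

theory Defs
  imports "HOL-Library.Poly_Mapping" "HOL-Algebra.QuotRing"
begin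

text \<open>
  Commutative rings are taken in the sort \<open>{comm_ring, comm_monoid_mult}\<close>: commutative rings with 1
  in which \<open>0 = 1\<close> is allowed. The class \<open>comm_ring_1\<close> would exclude the zero ring.
  A commutative \<open>k\<close>-algebra \<open>A\<close> is given by its structure map \<open>\<iota> : k \<rightarrow> A\<close>, so that
  \<open>c \<cdot> a = \<iota> c * a\<close>.
\<close>

locale k_algebra =
  fixes \<iota> :: "'k::{comm_ring, comm_monoid_mult} \<Rightarrow> 'a::{comm_ring, comm_monoid_mult}"
  assumes structure_add: "\<iota> (c + d) = \<iota> c + \<iota> d"
    and structure_mult: "\<iota> (c * d) = \<iota> c * \<iota> d"
    and structure_one: "\<iota> 1 = 1"

definition k_derivation ::
    "('k \<Rightarrow> 'a) \<Rightarrow> ('a::{comm_ring, comm_monoid_mult} \<Rightarrow> 'a) \<Rightarrow> bool" where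
  "k_derivation \<iota> D \<longleftrightarrow>
     (\<forall>a b. D (a + b) = D a + D b) \<and>
     (\<forall>c a. D (\<iota> c * a) = \<iota> c * D a) \<and>
     (\<forall>a b. D (a * b) = a * D b + b * D a)"

locale left_module =
  fixes smul :: "'a::{comm_ring, comm_monoid_mult} \<Rightarrow> 'l::ab_group_add \<Rightarrow> 'l" (infixr \<open>\<odot>\<close> 75)
  assumes smul_add_right: "a \<odot> (x + y) = a \<odot> x + a \<odot> y"
    and smul_add_left: "(a + b) \<odot> x = a \<odot> x + b \<odot> x"
    and smul_smul: "a \<odot> (b \<odot> x) = (a * b) \<odot> x"
    and smul_one: "1 \<odot> x = x"

text \<open>
  The \<open>k\<close>-module structure of \<open>L\<close> is the restriction of its \<open>A\<close>-module structure along \<open>\<iota>\<close>.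
  The bracket \<open>[x, y]\<close> is \<open>lie x y\<close>, and \<open>x(a)\<close> is \<open>\<rho> x a\<close>.
\<close>

locale lie_rinehart = k_algebra \<iota> + left_module smul
  for \<iota> :: "'k::{comm_ring, comm_monoid_mult} \<Rightarrow> 'a::{comm_ring, comm_monoid_mult}"
    and smul :: "'a \<Rightarrow> 'l::ab_group_add \<Rightarrow> 'l" (infixr \<open>\<odot>\<close> 75) +
  fixes lie :: "'l \<Rightarrow> 'l \<Rightarrow> 'l"
    and \<rho> :: "'l \<Rightarrow> 'a \<Rightarrow> 'a"
  assumes lie_add_left: "lie (x + y) z = lie x z + lie y z"
    and lie_add_right: "lie x (y + z) = lie x y + lie x z"
    and lie_scale_left: "lie (\<iota> c \<odot> x) y = \<iota> c \<odot> lie x y"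
    and lie_scale_right: "lie x (\<iota> c \<odot> y) = \<iota> c \<odot> lie x y"
    and lie_self: "lie x x = 0"
    and lie_jacobi: "lie x (lie y z) + lie y (lie z x) + lie z (lie x y) = 0"
    and anchor_derivation: "k_derivation \<iota> (\<rho> x)"
    and anchor_add: "\<rho> (x + y) a = \<rho> x a + \<rho> y a"
    and anchor_smul: "\<rho> (b \<odot> x) a = b * \<rho> x a"
    and anchor_lie: "\<rho> (lie x y) a = \<rho> x (\<rho> y a) - \<rho> y (\<rho> x a)"
    and lie_smul: "lie x (a \<odot> y) = a \<odot> lie x y + \<rho> x a \<odot> y"

text \<open>
  The polynomial algebra on a type \<open>'v\<close> of variables: finitely supported functions from
  monomials (finitely supported exponent vectors) to coefficients, with the convolution product.
  Its unit is written \<open>single 0 1\<close> because the constant \<open>1\<close> of \<open>poly_mapping\<close> requires \<open>0 \<noteq> 1\<close>.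
\<close>

type_synonym ('v, 'a) mpoly = "('v \<Rightarrow>\<^sub>0 nat) \<Rightarrow>\<^sub>0 'a"

definition const :: "'a \<Rightarrow> ('v, 'a::{comm_ring, comm_monoid_mult}) mpoly" where
  "const a = Poly_Mapping.single 0 a"

definition var :: "'v \<Rightarrow> ('v, 'a::{comm_ring, comm_monoid_mult}) mpoly" where
  "var v = Poly_Mapping.single (Poly_Mapping.single v 1) 1"

definition poly_ring :: "('v, 'a::{comm_ring, comm_monoid_mult}) mpoly ring" where
  "poly_ring = \<lparr>carrier = UNIV, mult = (*), one = const 1, zero = 0, add = (+)\<rparr>"

text \<open>The variable \<open>(\<lambda>, n)\<close>, that is \<open>x\<^bsub>\<lambda>,n\<^esub>\<close>, has degree \<open>n\<close>. Degrees are integers, so that the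
  component of degree \<open>- 1\<close> exists and is zero.\<close>

definition weight :: "('l \<times> nat \<Rightarrow>\<^sub>0 nat) \<Rightarrow> nat" where
  "weight m = (\<Sum>v\<in>Poly_Mapping.keys m. Poly_Mapping.lookup m v * snd v)"

definition homogeneous :: "int \<Rightarrow> ('l \<times> nat, 'a::{comm_ring, comm_monoid_mult}) mpoly set" where
  "homogeneous d = {p. \<forall>m\<in>Poly_Mapping.keys p. int (weight m) = d}"

text \<open>The integer multiple by a binomial coefficient is written as an iterated sum, because
  \<open>of_nat\<close> requires \<open>0 \<noteq> 1\<close>.\<close>

definition dp_relations ::
    "('a::{comm_ring, comm_monoid_mult} \<Rightarrow> 'l::ab_group_add \<Rightarrow> 'l) \<Rightarrow> ('l \<times> nat, 'a) mpoly set" where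
  "dp_relations smul =
     {var (x, 0) - const 1 | x. True} \<union>
     {var (smul a x, m) - const (a ^ m) * var (x, m) | a x m. True} \<union>
     {var (x, m) * var (x, n) - (\<Sum>i<(m + n) choose m. var (x, m + n)) | x m n. True} \<union>
     {var (x + y, m) - (\<Sum>i\<le>m. var (x, i) * var (y, m - i)) | x y m. True}"

definition dp_ideal ::
    "('a::{comm_ring, comm_monoid_mult} \<Rightarrow> 'l::ab_group_add \<Rightarrow> 'l) \<Rightarrow> ('l \<times> nat, 'a) mpoly set" where
  "dp_ideal smul = Idl\<^bsub>poly_ring\<^esub> (dp_relations smul)"

definition dp_algebra ::
    "('a::{comm_ring, comm_monoid_mult} \<Rightarrow> 'l::ab_group_add \<Rightarrow> 'l) \<Rightarrow> ('l \<times> nat, 'a) mpoly set ring" where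
  "dp_algebra smul = poly_ring Quot (dp_ideal smul)"

definition dp_class ::
    "('a::{comm_ring, comm_monoid_mult} \<Rightarrow> 'l::ab_group_add \<Rightarrow> 'l) \<Rightarrow> ('l \<times> nat, 'a) mpoly
      \<Rightarrow> ('l \<times> nat, 'a) mpoly set" where
  "dp_class smul p = dp_ideal smul +>\<^bsub>poly_ring\<^esub> p"

definition dp_scalar ::
    "('a::{comm_ring, comm_monoid_mult} \<Rightarrow> 'l::ab_group_add \<Rightarrow> 'l) \<Rightarrow> 'a \<Rightarrow> ('l \<times> nat, 'a) mpoly set" where
  "dp_scalar smul a = dp_class smul (const a)"

definition dp_gamma ::
    "('a::{comm_ring, comm_monoid_mult} \<Rightarrow> 'l::ab_group_add \<Rightarrow> 'l) \<Rightarrow> nat \<Rightarrow> 'l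
      \<Rightarrow> ('l \<times> nat, 'a) mpoly set" where
  "dp_gamma smul n x = dp_class smul (var (x, n))"

definition dp_component ::
    "('a::{comm_ring, comm_monoid_mult} \<Rightarrow> 'l::ab_group_add \<Rightarrow> 'l) \<Rightarrow> int
      \<Rightarrow> ('l \<times> nat, 'a) mpoly set set" where
  "dp_component smul d = dp_class smul ` homogeneous d"

text \<open>
  \<open>R\<close> is a commutative \<open>k\<close>-algebra through \<open>\<eta> : k \<rightarrow> R\<close>. Values of \<open>pb\<close> outside \<open>carrier R\<close> are
  immaterial.
\<close>

locale poisson_structure = cring R
  for R :: "('r, 'm) ring_scheme" (structure) +
  fixes \<eta> :: "'k::{comm_ring, comm_monoid_mult} \<Rightarrow> 'r"
    and pb :: "'r \<Rightarrow> 'r \<Rightarrow> 'r"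
  assumes eta_closed: "\<eta> c \<in> carrier R"
    and eta_add: "\<eta> (c + d) = \<eta> c \<oplus> \<eta> d"
    and eta_mult: "\<eta> (c * d) = \<eta> c \<otimes> \<eta> d"
    and eta_one: "\<eta> 1 = \<one>"
    and pb_closed: "\<lbrakk>r \<in> carrier R; s \<in> carrier R\<rbrakk> \<Longrightarrow> pb r s \<in> carrier R"
    and pb_add_left: "\<lbrakk>r \<in> carrier R; s \<in> carrier R; t \<in> carrier R\<rbrakk>
      \<Longrightarrow> pb (r \<oplus> s) t = pb r t \<oplus> pb s t"
    and pb_add_right: "\<lbrakk>r \<in> carrier R; s \<in> carrier R; t \<in> carrier R\<rbrakk>
      \<Longrightarrow> pb r (s \<oplus> t) = pb r s \<oplus> pb r t"
    and pb_scale_left: "\<lbrakk>r \<in> carrier R; s \<in> carrier R\<rbrakk> \<Longrightarrow> pb (\<eta> c \<otimes> r) s = \<eta> c \<otimes> pb r s"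
    and pb_scale_right: "\<lbrakk>r \<in> carrier R; s \<in> carrier R\<rbrakk> \<Longrightarrow> pb r (\<eta> c \<otimes> s) = \<eta> c \<otimes> pb r s"
    and pb_leibniz_left: "\<lbrakk>r \<in> carrier R; s \<in> carrier R; t \<in> carrier R\<rbrakk>
      \<Longrightarrow> pb (r \<otimes> s) t = r \<otimes> pb s t \<oplus> s \<otimes> pb r t"
    and pb_leibniz_right: "\<lbrakk>r \<in> carrier R; s \<in> carrier R; t \<in> carrier R\<rbrakk>
      \<Longrightarrow> pb r (s \<otimes> t) = s \<otimes> pb r t \<oplus> t \<otimes> pb r s"
    and pb_self: "r \<in> carrier R \<Longrightarrow> pb r r = \<zero>"
    and pb_jacobi: "\<lbrakk>r \<in> carrier R; s \<in> carrier R; t \<in> carrier R\<rbrakk>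
      \<Longrightarrow> pb r (pb s t) \<oplus> pb s (pb t r) \<oplus> pb t (pb r s) = \<zero>"

definition graded_degree_minus_one :: "(int \<Rightarrow> 'r set) \<Rightarrow> ('r \<Rightarrow> 'r \<Rightarrow> 'r) \<Rightarrow> bool" where
  "graded_degree_minus_one G pb \<longleftrightarrow> (\<forall>d e. \<forall>r\<in>G d. \<forall>s\<in>G e. pb r s \<in> G (d + e - 1))"

definition dp_poisson ::
    "('k::{comm_ring, comm_monoid_mult} \<Rightarrow> 'a::{comm_ring, comm_monoid_mult})
      \<Rightarrow> ('a \<Rightarrow> 'l::ab_group_add \<Rightarrow> 'l) \<Rightarrow> ('l \<Rightarrow> 'l \<Rightarrow> 'l) \<Rightarrow> ('l \<Rightarrow> 'a \<Rightarrow> 'a)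
      \<Rightarrow> (('l \<times> nat, 'a) mpoly set \<Rightarrow> ('l \<times> nat, 'a) mpoly set \<Rightarrow> ('l \<times> nat, 'a) mpoly set)
      \<Rightarrow> bool" where
  "dp_poisson \<iota> smul lie \<rho> pb \<longleftrightarrow>
     poisson_structure (dp_algebra smul) (\<lambda>c. dp_scalar smul (\<iota> c)) pb \<and>
     (\<forall>a b. pb (dp_scalar smul a) (dp_scalar smul b) = \<zero>\<^bsub>dp_algebra smul\<^esub>) \<and>
     (\<forall>x a m. 1 \<le> m \<longrightarrow>
        pb (dp_gamma smul m x) (dp_scalar smul a) =
          dp_scalar smul (\<rho> x a) \<otimes>\<^bsub>dp_algebra smul\<^esub> dp_gamma smul (m - 1) x) \<and>
     (\<forall>x y m n. 1 \<le> m \<longrightarrow> 1 \<le> n \<longrightarrow>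
        pb (dp_gamma smul m x) (dp_gamma smul n y) =
          dp_gamma smul (m - 1) x \<otimes>\<^bsub>dp_algebra smul\<^esub> dp_gamma smul (n - 1) y
            \<otimes>\<^bsub>dp_algebra smul\<^esub> dp_gamma smul 1 (lie x y))"

end

theory Submission
  imports Defs
begin

text \<open>
  Write \<open>D\<^sub>x = {\<gamma>\<^sub>1(x), -}\<close> and \<open>C\<^sub>a = {a, -}\<close>. The required formulas say that
  \<open>{\<gamma>\<^sub>m(x), -} = \<gamma>\<^bsub>m-1\<^esub>(x) D\<^sub>x\<close>, where \<open>D\<^sub>x\<close> and \<open>C\<^sub>a\<close> are the derivations given by
  \<open>D\<^sub>x(a) = x(a)\<close>, \<open>D\<^sub>x(\<gamma>\<^sub>n(y)) = \<gamma>\<^bsub>n-1\<^esub>(y) \<gamma>\<^sub>1([x, y])\<close>, \<open>C\<^sub>a(b) = 0\<close> and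
  \<open>C\<^sub>a(\<gamma>\<^sub>n(y)) = - y(a) \<gamma>\<^bsub>n-1\<^esub>(y)\<close>. These formulas define a biderivation on the free polynomial
  algebra. Modulo the divided power relations it is skew-symmetric, hence it suffices that \<open>D\<^sub>x\<close> and
  \<open>C\<^sub>a\<close> preserve the ideal. The Jacobiator is a derivation in each argument modulo the ideal, so the
  Jacobi identity reduces to the commutators \<open>[D\<^sub>x, D\<^sub>y] = D\<^bsub>[x,y]\<^esub>\<close>, \<open>[C\<^sub>a, D\<^sub>y] = - C\<^bsub>y(a)\<^esub>\<close>
  and \<open>[C\<^sub>a, C\<^sub>b] = 0\<close>.
\<close>

section \<open>Derivations of polynomial algebras\<close>

lemma poly_mapping_add_induct [case_names single add]:
  assumes "\<And>k c. Q (Poly_Mapping.single k c)"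
    and "\<And>p q. Q p \<Longrightarrow> Q q \<Longrightarrow> Q (p + q)"
  shows "Q (p :: 'b \<Rightarrow>\<^sub>0 'c::comm_monoid_add)"
proof (induction p rule: Poly_Mapping.update_induct)
  case const
  have "Q (Poly_Mapping.single undefined 0)" by (rule assms(1))
  then show ?case by simp
next
  case (update p k b)
  have "Poly_Mapping.update k b p = p + Poly_Mapping.single k b"
    using update by (intro poly_mapping_eqI)
      (auto simp: lookup_update lookup_add lookup_single when_def in_keys_iff)
  then show ?case using update assms by metis
qed

definition monomial :: "('v \<Rightarrow>\<^sub>0 nat) \<Rightarrow> ('v, 'a::{comm_ring, comm_monoid_mult}) mpoly" where
  "monomial m = Poly_Mapping.single m 1"

lemma const_add: "const (a + b) = const a + const b"
  by (simp add: const_def single_add)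

lemma const_mult: "const (a * b) = const a * const b"
  by (simp add: const_def mult_single)

lemma const_zero [simp]: "const 0 = 0"
  by (simp add: const_def)

lemma const_uminus: "const (- a) = - const a"
  by (simp add: const_def single_uminus)

lemma const_diff: "const (a - b) = const a - const b"
  by (simp add: const_def single_diff)

lemma const_one_mult [simp]: "const 1 * p = p"
  by (induction p rule: poly_mapping_add_induct) (simp_all add: const_def mult_single distrib_left)

lemma mult_const_one [simp]: "p * const 1 = p"
  by (metis const_one_mult mult.commute)

lemma monomial_zero: "monomial 0 = const 1"
  by (simp add: monomial_def const_def)

lemma monomial_add: "monomial (m + n) = monomial m * monomial n"
  by (simp add: monomial_def mult_single)

lemma single_conv_monomial: "Poly_Mapping.single m c = const c * monomial m"
  by (simp add: monomial_def const_def mult_single)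

lemma mpoly_induct [case_names const var add mult]:
  fixes p :: "('v, 'a::{comm_ring, comm_monoid_mult}) mpoly"
  assumes const: "\<And>a. Q (const a)" and var: "\<And>v. Q (var v)"
    and add: "\<And>p q. Q p \<Longrightarrow> Q q \<Longrightarrow> Q (p + q)"
    and mult: "\<And>p q. Q p \<Longrightarrow> Q q \<Longrightarrow> Q (p * q)"
  shows "Q p"
proof (induction p rule: poly_mapping_add_induct)
  case (single m c)
  have pow: "Q (monomial (Poly_Mapping.single v n))" for v n
  proof (induction n)
    case (Suc n)
    have "Poly_Mapping.single v (Suc n) = Poly_Mapping.single v 1 + Poly_Mapping.single v n"
      by (simp flip: single_add)
    then have "monomial (Poly_Mapping.single v (Suc n))
        = var v * monomial (Poly_Mapping.single v n)"
      by (simp add: monomial_add) (simp add: monomial_def var_def)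
    then show ?case using Suc var mult by metis
  qed (use const in \<open>simp add: monomial_zero\<close>)
  have "Q (monomial m)"
    by (induction m rule: poly_mapping_add_induct) (simp_all add: pow monomial_add mult)
  then show ?case
    by (simp add: single_conv_monomial const mult)
qed (rule add)

definition nat_multiple :: "nat \<Rightarrow> 'b::comm_monoid_add \<Rightarrow> 'b" where
  "nat_multiple n p = (\<Sum>i<n. p)"

lemma nat_multiple_0 [simp]: "nat_multiple 0 p = 0"
  and nat_multiple_Suc: "nat_multiple (Suc n) p = nat_multiple n p + p"
  and nat_multiple_one [simp]: "nat_multiple (Suc 0) p = p"
  by (simp_all add: nat_multiple_def)

lemma nat_multiple_add: "nat_multiple (m + n) p = nat_multiple m p + nat_multiple n p"
  by (induction n) (simp_all add: nat_multiple_Suc add.assoc)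

lemma nat_multiple_mult_left: "nat_multiple n p * q = nat_multiple n (p * (q::'b::comm_ring))"
  by (simp add: nat_multiple_def sum_distrib_right)

lemma nat_multiple_mult_right: "q * nat_multiple n p = nat_multiple n (q * (p::'b::comm_ring))"
  by (simp add: nat_multiple_def sum_distrib_left)

definition derivation :: "('b::comm_ring \<Rightarrow> 'b) \<Rightarrow> bool" where
  "derivation D \<longleftrightarrow> (\<forall>p q. D (p + q) = D p + D q) \<and> (\<forall>p q. D (p * q) = p * D q + q * D p)"

lemma derivation_add: "derivation D \<Longrightarrow> D (p + q) = D p + D q"
  and derivation_mult: "derivation D \<Longrightarrow> D (p * q) = p * D q + q * D p"
  by (simp_all add: derivation_def)

lemma derivation_zero: assumes "derivation D" shows "D 0 = 0"
  using derivation_add[OF assms, of 0 0] by simp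

lemma derivation_uminus: assumes "derivation D" shows "D (- p) = - D p"
  using derivation_add[OF assms, of p "- p"] derivation_zero[OF assms]
  by (simp add: eq_neg_iff_add_eq_0 add.commute)

lemma derivation_diff: "derivation D \<Longrightarrow> D (p - q) = D p - D q"
  using derivation_add[of D p "- q"] derivation_uminus[of D q] by simp

lemma derivation_sum: "derivation D \<Longrightarrow> D (sum f S) = (\<Sum>i\<in>S. D (f i))"
  by (induction S rule: infinite_finite_induct) (simp_all add: derivation_zero derivation_add)

lemma derivation_nat_multiple: "derivation D \<Longrightarrow> D (nat_multiple n p) = nat_multiple n (D p)"
  by (simp add: nat_multiple_def derivation_sum)

lemma derivation_const_one: assumes "derivation D" shows "D (const 1) = 0"
  using derivation_mult[OF assms, of "const 1" "const 1"] by simp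

definition monomial_der :: "('v \<Rightarrow> ('v, 'a) mpoly) \<Rightarrow> ('v \<Rightarrow>\<^sub>0 nat)
    \<Rightarrow> ('v, 'a::{comm_ring, comm_monoid_mult}) mpoly" where
  "monomial_der d m = (\<Sum>v\<in>Poly_Mapping.keys m.
     nat_multiple (Poly_Mapping.lookup m v) (monomial (m - Poly_Mapping.single v 1) * d v))"

lemma monomial_der_superset:
  assumes "finite S" "Poly_Mapping.keys m \<subseteq> S"
  shows "monomial_der d m = (\<Sum>v\<in>S.
     nat_multiple (Poly_Mapping.lookup m v) (monomial (m - Poly_Mapping.single v 1) * d v))"
  unfolding monomial_der_def using assms
  by (intro sum.mono_neutral_left) (auto simp: in_keys_iff)

lemma monomial_der_add:
  "monomial_der d (m + n) = monomial m * monomial_der d n + monomial n * monomial_der d m"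
proof -
  let ?S = "Poly_Mapping.keys m \<union> Poly_Mapping.keys n"
  have aux: "nat_multiple (Poly_Mapping.lookup m v) (monomial (m + n - Poly_Mapping.single v 1) * d v)
      = monomial n * nat_multiple (Poly_Mapping.lookup m v) (monomial (m - Poly_Mapping.single v 1) * d v)"
    for m n :: "'a \<Rightarrow>\<^sub>0 nat" and v
  proof (cases "Poly_Mapping.lookup m v = 0")
    case False
    have "m + n - Poly_Mapping.single v 1 = n + (m - Poly_Mapping.single v 1)"
      using False by (intro poly_mapping_eqI) (auto simp: lookup_add lookup_minus lookup_single when_def)
    then show ?thesis by (simp add: monomial_add nat_multiple_mult_right mult.assoc)
  qed simp
  have "monomial_der d (m + n) = (\<Sum>v\<in>?S.
     nat_multiple (Poly_Mapping.lookup (m + n) v) (monomial (m + n - Poly_Mapping.single v 1) * d v))"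
    using keys_add[of m n] by (intro monomial_der_superset) auto
  also have "\<dots> = (\<Sum>v\<in>?S. monomial m * nat_multiple (Poly_Mapping.lookup n v) (monomial (n - Poly_Mapping.single v 1) * d v)
      + monomial n * nat_multiple (Poly_Mapping.lookup m v) (monomial (m - Poly_Mapping.single v 1) * d v))"
    unfolding lookup_add nat_multiple_add aux[of m _ n] aux[of n _ m, unfolded add.commute[of n m]]
    by (simp only: add.commute)
  also have "\<dots> = monomial m * monomial_der d n + monomial n * monomial_der d m"
    by (simp add: sum.distrib sum_distrib_left monomial_der_superset[of ?S])
  finally show ?thesis .
qed

definition extend_der :: "('a \<Rightarrow> ('v, 'a) mpoly) \<Rightarrow> ('v \<Rightarrow> ('v, 'a) mpoly) \<Rightarrow> ('v, 'a) mpoly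
    \<Rightarrow> ('v, 'a::{comm_ring, comm_monoid_mult}) mpoly" where
  "extend_der \<delta> d p = (\<Sum>m\<in>Poly_Mapping.keys p.
     \<delta> (Poly_Mapping.lookup p m) * monomial m + const (Poly_Mapping.lookup p m) * monomial_der d m)"

context
  fixes \<delta> :: "'a \<Rightarrow> ('v, 'a::{comm_ring, comm_monoid_mult}) mpoly"
    and d :: "'v \<Rightarrow> ('v, 'a) mpoly"
  assumes scalar_add: "\<And>a b. \<delta> (a + b) = \<delta> a + \<delta> b"
    and scalar_mult: "\<And>a b. \<delta> (a * b) = const a * \<delta> b + const b * \<delta> a"
begin

lemma scalar_zero: "\<delta> 0 = 0"
  using scalar_add[of 0 0] by simp

lemma extend_der_add: "extend_der \<delta> d (p + q) = extend_der \<delta> d p + extend_der \<delta> d q"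
  unfolding extend_der_def
  by (rule setsum_keys_plus_distrib) (simp_all add: scalar_add scalar_zero const_add algebra_simps)

lemma extend_der_single:
  "extend_der \<delta> d (Poly_Mapping.single m c) = \<delta> c * monomial m + const c * monomial_der d m"
  by (cases "c = 0") (simp_all add: extend_der_def scalar_zero)

lemma extend_der_mult_single:
  "extend_der \<delta> d (Poly_Mapping.single m a * Poly_Mapping.single n b)
    = Poly_Mapping.single m a * extend_der \<delta> d (Poly_Mapping.single n b)
      + Poly_Mapping.single n b * extend_der \<delta> d (Poly_Mapping.single m a)"
  unfolding mult_single extend_der_single
  by (simp add: single_conv_monomial monomial_add monomial_der_add scalar_mult const_mult algebra_simps)

lemma extend_der_mult: "extend_der \<delta> d (p * q) = p * extend_der \<delta> d q + q * extend_der \<delta> d p"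
proof (induction p rule: poly_mapping_add_induct)
  case (single m a)
  show ?case
    by (induction q rule: poly_mapping_add_induct)
      (simp_all add: extend_der_mult_single extend_der_add algebra_simps)
qed (simp add: extend_der_add algebra_simps)

lemma derivation_extend_der: "derivation (extend_der \<delta> d)"
  by (simp add: derivation_def extend_der_add extend_der_mult)

lemma extend_der_const [simp]: "extend_der \<delta> d (const a) = \<delta> a"
  by (simp add: const_def extend_der_single monomial_der_def)
    (simp add: monomial_zero)

lemma extend_der_var [simp]: "extend_der \<delta> d (var v) = d v"
proof -
  have "\<delta> 1 = 0" using scalar_mult[of 1 1] by simp
  then show ?thesis
    by (simp add: var_def extend_der_single monomial_der_def monomial_zero)
qed

end

lemma homogeneous_zero [simp]: "0 \<in> homogeneous d"
  by (simp add: homogeneous_def)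

lemma homogeneous_add: "p \<in> homogeneous d \<Longrightarrow> q \<in> homogeneous d \<Longrightarrow> p + q \<in> homogeneous d"
  using keys_add[of p q] by (auto simp: homogeneous_def)

lemma homogeneous_sum: "(\<And>i. i \<in> S \<Longrightarrow> f i \<in> homogeneous d) \<Longrightarrow> sum f S \<in> homogeneous d"
  by (induction S rule: infinite_finite_induct) (simp_all add: homogeneous_add)

lemma weight_superset:
  assumes "finite S" "Poly_Mapping.keys m \<subseteq> S"
  shows "weight m = (\<Sum>v\<in>S. Poly_Mapping.lookup m v * snd v)"
  unfolding weight_def using assms by (intro sum.mono_neutral_left) (auto simp: in_keys_iff)

lemma weight_add: "weight (m + n) = weight m + weight n"
proof -
  let ?S = "Poly_Mapping.keys m \<union> Poly_Mapping.keys n"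
  show ?thesis
    using keys_add[of m n]
    by (simp add: weight_superset[of ?S] lookup_add sum.distrib algebra_simps)
qed

lemma weight_single: "weight (Poly_Mapping.single v n) = n * snd v"
  by (cases "n = 0") (simp_all add: weight_def)

lemma homogeneous_mult:
  assumes "p \<in> homogeneous d" "q \<in> homogeneous e" shows "p * q \<in> homogeneous (d + e)"
  using keys_mult[of p q] assms by (fastforce simp: homogeneous_def weight_add)

lemma homogeneous_const: "const a \<in> homogeneous 0"
  by (simp add: homogeneous_def const_def weight_def)

lemma homogeneous_var: "var v \<in> homogeneous (int (snd v))"
  by (simp add: homogeneous_def var_def weight_single)

lemma homogeneous_monomial: "monomial m \<in> homogeneous (int (weight m))"
  by (simp add: homogeneous_def monomial_def)

lemma derivation_homogeneous:
  fixes D :: "('l \<times> nat, 'a::{comm_ring, comm_monoid_mult}) mpoly \<Rightarrow> ('l \<times> nat, 'a) mpoly"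
  assumes D: "derivation D"
    and const: "\<And>a. D (const a) \<in> homogeneous k"
    and var: "\<And>v. D (var v) \<in> homogeneous (int (snd v) + k)"
    and p: "p \<in> homogeneous d"
  shows "D p \<in> homogeneous (d + k)"
proof -
  have pow: "D (monomial (Poly_Mapping.single v n)) \<in> homogeneous (int (n * snd v) + k)" for v n
  proof (induction n)
    case 0
    then show ?case by (simp add: monomial_zero derivation_const_one[OF D])
  next
    case (Suc n)
    have "Poly_Mapping.single v (Suc n) = Poly_Mapping.single v 1 + Poly_Mapping.single v n"
      by (simp flip: single_add)
    then have *: "monomial (Poly_Mapping.single v (Suc n))
        = var v * monomial (Poly_Mapping.single v n)"
      by (simp add: monomial_add) (simp add: monomial_def var_def)
    have "var v * D (monomial (Poly_Mapping.single v n)) \<in> homogeneous (int (Suc n * snd v) + k)"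
      using homogeneous_mult[OF homogeneous_var[of v] Suc] by (simp add: algebra_simps)
    moreover have "monomial (Poly_Mapping.single v n) * D (var v) \<in> homogeneous (int (Suc n * snd v) + k)"
      using homogeneous_mult[OF homogeneous_monomial[of "Poly_Mapping.single v n"] var[of v]]
      by (simp add: algebra_simps weight_single)
    ultimately show ?case unfolding * derivation_mult[OF D] by (rule homogeneous_add)
  qed
  have mon: "D (monomial m) \<in> homogeneous (int (weight m) + k)" for m
  proof (induction m rule: poly_mapping_add_induct)
    case (single v n)
    show ?case using pow[of v n] by (simp add: weight_single)
  next
    case (add m n)
    show ?case unfolding monomial_add derivation_mult[OF D]
      using homogeneous_mult[OF homogeneous_monomial[of m] add(2)]
        homogeneous_mult[OF homogeneous_monomial[of n] add(1)]
      by (intro homogeneous_add) (simp_all add: weight_add algebra_simps)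
  qed
  have "p = (\<Sum>m\<in>Poly_Mapping.keys p. const (Poly_Mapping.lookup p m) * monomial m)"
    by (rule poly_mapping_eqI)
      (auto simp: lookup_sum lookup_single when_def in_keys_iff simp flip: single_conv_monomial)
  then have "D p = (\<Sum>m\<in>Poly_Mapping.keys p. D (const (Poly_Mapping.lookup p m) * monomial m))"
    using derivation_sum[OF D] by metis
  also have "\<dots> \<in> homogeneous (d + k)"
  proof (rule homogeneous_sum)
    fix m assume m: "m \<in> Poly_Mapping.keys p"
    let ?c = "Poly_Mapping.lookup p m"
    have w: "int (weight m) = d" using p m by (simp add: homogeneous_def)
    show "D (const ?c * monomial m) \<in> homogeneous (d + k)"
      unfolding derivation_mult[OF D]
      using homogeneous_mult[OF homogeneous_const[of ?c] mon[of m]]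
        homogeneous_mult[OF homogeneous_monomial[of m] const[of ?c]]
      by (intro homogeneous_add) (simp_all add: w)
  qed
  finally show ?thesis .
qed

section \<open>The divided power ideal\<close>

lemma derivation_plus: "derivation D \<Longrightarrow> derivation E \<Longrightarrow> derivation (\<lambda>p. D p + E p)"
  by (simp add: derivation_def algebra_simps)

lemma derivation_minus: "derivation D \<Longrightarrow> derivation E \<Longrightarrow> derivation (\<lambda>p. D p - E p)"
  by (simp add: derivation_def algebra_simps)

lemma derivation_times: "derivation D \<Longrightarrow> derivation (\<lambda>p. r * D p)"
  by (simp add: derivation_def algebra_simps)

lemma derivation_commutator: "derivation D \<Longrightarrow> derivation E \<Longrightarrow> derivation (\<lambda>p. D (E p) - E (D p))"
  by (simp add: derivation_def algebra_simps)

lemma derivation_eqI: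
  fixes D E :: "('v, 'a::{comm_ring, comm_monoid_mult}) mpoly \<Rightarrow> ('v, 'a) mpoly"
  assumes "derivation D" "derivation E"
    and "\<And>a. D (const a) = E (const a)" "\<And>v. D (var v) = E (var v)"
  shows "D p = E p"
  by (induction p rule: mpoly_induct)
    (simp_all add: assms derivation_add[OF assms(1)] derivation_add[OF assms(2)]
      derivation_mult[OF assms(1)] derivation_mult[OF assms(2)])

lemma derivation_const_power:
  assumes D: "derivation D"
  shows "D (const (b ^ Suc k)) = nat_multiple (Suc k) (const (b ^ k) * D (const b))"
proof (induction k)
  case (Suc k)
  have "D (const (b ^ Suc (Suc k))) = const b * D (const (b ^ Suc k)) + const (b ^ Suc k) * D (const b)"
    unfolding power_Suc[of b "Suc k"] const_mult[of b] derivation_mult[OF D] ..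
  also have "const b * D (const (b ^ Suc k)) = nat_multiple (Suc k) (const (b ^ Suc k) * D (const b))"
    unfolding Suc by (simp add: nat_multiple_mult_right const_mult mult.assoc)
  finally show ?case by (simp only: nat_multiple_Suc)
qed simp

lemma cring_poly_ring: "cring (poly_ring :: ('v, 'a::{comm_ring, comm_monoid_mult}) mpoly ring)"
proof (rule cringI)
  show "abelian_group (poly_ring :: ('v, 'a) mpoly ring)"
    by (rule abelian_groupI) (auto simp: poly_ring_def algebra_simps, metis right_minus)
  show "comm_monoid (poly_ring :: ('v, 'a) mpoly ring)"
    by (rule comm_monoidI) (auto simp: poly_ring_def algebra_simps)
qed (simp add: poly_ring_def distrib_right)

lemma carrier_poly_ring [simp]: "carrier poly_ring = UNIV"
  and add_poly_ring [simp]: "add poly_ring = (+)"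
  and mult_poly_ring [simp]: "mult poly_ring = (*)"
  and zero_poly_ring [simp]: "zero poly_ring = 0"
  and one_poly_ring [simp]: "one poly_ring = const 1"
  by (simp_all add: poly_ring_def)

lemma ideal_dp_ideal: "ideal (dp_ideal smul) poly_ring"
  unfolding dp_ideal_def
  by (rule ring.genideal_ideal[OF cring.axioms(1)[OF cring_poly_ring]]) simp

lemma dp_ideal_zero [simp]: "0 \<in> dp_ideal smul"
  using additive_subgroup.zero_closed[OF ideal.axioms(1)[OF ideal_dp_ideal]] by simp

lemma dp_ideal_add: "p \<in> dp_ideal smul \<Longrightarrow> q \<in> dp_ideal smul \<Longrightarrow> p + q \<in> dp_ideal smul"
  using additive_subgroup.a_closed[OF ideal.axioms(1)[OF ideal_dp_ideal]] by fastforce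

lemma dp_ideal_mult: "p \<in> dp_ideal smul \<Longrightarrow> q * p \<in> dp_ideal smul"
  using ideal.I_l_closed[OF ideal_dp_ideal] by fastforce

lemma dp_ideal_mult_right: "p \<in> dp_ideal smul \<Longrightarrow> p * q \<in> dp_ideal smul"
  unfolding mult.commute[of p] by (rule dp_ideal_mult)

lemma dp_ideal_uminus: "p \<in> dp_ideal smul \<Longrightarrow> - p \<in> dp_ideal smul"
  using dp_ideal_mult[of p smul "const (- 1)"] by (simp only: const_uminus mult_minus_left const_one_mult)

lemma dp_ideal_diff: "p \<in> dp_ideal smul \<Longrightarrow> q \<in> dp_ideal smul \<Longrightarrow> p - q \<in> dp_ideal smul"
  using dp_ideal_add[of p smul "- q"] dp_ideal_uminus[of q smul] by simp

lemma dp_ideal_minimal: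
  fixes smul :: "'a::{comm_ring, comm_monoid_mult} \<Rightarrow> 'l::ab_group_add \<Rightarrow> 'l"
  assumes "dp_relations smul \<subseteq> J" "0 \<in> J"
    and "\<And>p q. p \<in> J \<Longrightarrow> q \<in> J \<Longrightarrow> p + q \<in> J" "\<And>p q. p \<in> J \<Longrightarrow> q * p \<in> J"
  shows "dp_ideal smul \<subseteq> J"
  unfolding dp_ideal_def
proof (rule ring.genideal_minimal[OF cring.axioms(1)[OF cring_poly_ring]])
  have uminus: "- p \<in> J" if "p \<in> J" for p
    using assms(4)[OF that, of "const (- 1)"] by (simp only: const_uminus mult_minus_left const_one_mult)
  have inv: "inv\<^bsub>add_monoid poly_ring\<^esub> p = - p" for p :: "('l \<times> nat, 'a) mpoly"
    by (rule group.inv_equality[OF abelian_group.a_group])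
      (simp_all add: cring_poly_ring cring.axioms(1) ring.is_abelian_group)
  show "ideal J poly_ring"
  proof (rule idealI)
    show "ring (poly_ring :: ('l \<times> nat, 'a) mpoly ring)" by (rule cring.axioms(1)[OF cring_poly_ring])
    show "subgroup J (add_monoid poly_ring)"
    proof (rule subgroup.intro)
      show "inv\<^bsub>add_monoid poly_ring\<^esub> p \<in> J" if "p \<in> J" for p
        unfolding inv by (rule uminus[OF that])
    qed (use assms in auto)
  qed (use assms in \<open>auto simp: mult.commute\<close>)
qed (rule assms)

context left_module
begin

definition cong :: "('l \<times> nat, 'a) mpoly \<Rightarrow> ('l \<times> nat, 'a) mpoly \<Rightarrow> bool" (infix \<open>\<approx>\<close> 50) where
  "p \<approx> q \<longleftrightarrow> p - q \<in> dp_ideal smul"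

lemma cong_refl [simp]: "p \<approx> p"
  by (simp add: cong_def)

lemma cong_sym: "p \<approx> q \<Longrightarrow> q \<approx> p"
  using dp_ideal_uminus[of "p - q" smul] by (simp add: cong_def)

lemma cong_trans [trans]: "p \<approx> q \<Longrightarrow> q \<approx> r \<Longrightarrow> p \<approx> r"
  using dp_ideal_add[of "p - q" smul "q - r"] by (simp add: cong_def)

lemma eq_cong_trans [trans]: "p = q \<Longrightarrow> q \<approx> r \<Longrightarrow> p \<approx> r"
  and cong_eq_trans [trans]: "p \<approx> q \<Longrightarrow> q = r \<Longrightarrow> p \<approx> r"
  by simp_all

lemma cong_zero_iff: "p \<approx> 0 \<longleftrightarrow> p \<in> dp_ideal smul"
  by (simp add: cong_def)

lemma cong_add: "p \<approx> p' \<Longrightarrow> q \<approx> q' \<Longrightarrow> p + q \<approx> p' + q'"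
  using dp_ideal_add[of "p - p'" smul "q - q'"] by (simp add: cong_def algebra_simps)

lemma cong_uminus: "p \<approx> p' \<Longrightarrow> - p \<approx> - p'"
  using dp_ideal_uminus[of "p - p'" smul] by (simp add: cong_def)

lemma cong_diff: "p \<approx> p' \<Longrightarrow> q \<approx> q' \<Longrightarrow> p - q \<approx> p' - q'"
  using cong_add[of p p' "- q" "- q'"] cong_uminus by simp

lemma cong_mult:
  assumes "p \<approx> p'" "q \<approx> q'" shows "p * q \<approx> p' * q'"
proof -
  have "p * q - p' * q' = q * (p - p') + p' * (q - q')"
    by (simp add: algebra_simps)
  then show ?thesis
    using assms by (simp add: cong_def dp_ideal_add dp_ideal_mult)
qed

lemma cong_nat_multiple: "p \<approx> q \<Longrightarrow> nat_multiple n p \<approx> nat_multiple n q"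
  by (induction n) (simp_all add: nat_multiple_Suc cong_add)

lemmas cong_intros = cong_add cong_uminus cong_diff cong_mult cong_nat_multiple cong_refl

lemma dp_relations_cong:
  shows cong_gamma_0: "var (x, 0) \<approx> const 1"
    and cong_gamma_smul: "var (b \<odot> x, m) \<approx> const (b ^ m) * var (x, m)"
    and cong_gamma_mult: "var (x, m) * var (x, n) \<approx> nat_multiple ((m + n) choose m) (var (x, m + n))"
    and cong_gamma_add: "var (x + y, m) \<approx> (\<Sum>i\<le>m. var (x, i) * var (y, m - i))"
  unfolding cong_def nat_multiple_def dp_ideal_def
  by (intro subsetD[OF ring.genideal_self[OF cring.axioms(1)[OF cring_poly_ring]]];
      force simp: dp_relations_def)+

lemma cong_gamma_1_add: "var (x + y, Suc 0) \<approx> var (x, Suc 0) + var (y, Suc 0)"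
proof -
  have "var (x + y, Suc 0) \<approx> var (x, 0) * var (y, Suc 0) + var (x, Suc 0) * var (y, 0)"
    using cong_gamma_add[of x y "Suc 0"] by simp
  also have "\<dots> \<approx> const 1 * var (y, Suc 0) + var (x, Suc 0) * const 1"
    by (intro cong_intros cong_gamma_0)
  finally show ?thesis by (simp add: add.commute)
qed

lemma cong_gamma_1_smul: "var (b \<odot> x, Suc 0) \<approx> const b * var (x, Suc 0)"
  using cong_gamma_smul[of b x "Suc 0"] by simp

lemma cong_gamma_1_zero: "var (0, Suc 0) \<approx> 0"
  using cong_sym[OF cong_gamma_1_add[of 0 0]] by (simp add: cong_def)

lemma cong_gamma_1_uminus: "var (- x, Suc 0) \<approx> - var (x, Suc 0)"
proof -
  have "var (x, Suc 0) + var (- x, Suc 0) \<approx> 0"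
    using cong_sym[OF cong_gamma_1_add[of x "- x"]] cong_gamma_1_zero by (simp add: cong_trans)
  then show ?thesis by (simp add: cong_def algebra_simps)
qed

lemma cong_gamma_1_diff: "var (x - y, Suc 0) \<approx> var (x, Suc 0) - var (y, Suc 0)"
  using cong_trans[OF cong_gamma_1_add[of x "- y"] cong_add[OF cong_refl cong_gamma_1_uminus]] by simp

text \<open>\<open>lower x n\<close> represents \<open>\<gamma>\<^bsub>n-1\<^esub>(x)\<close>, with the convention \<open>\<gamma>\<^bsub>-1\<^esub>(x) = 0\<close>.\<close>

definition lower :: "'l \<Rightarrow> nat \<Rightarrow> ('l \<times> nat, 'a) mpoly" where
  "lower x n = (case n of 0 \<Rightarrow> 0 | Suc k \<Rightarrow> var (x, k))"

lemma lower_simps [simp]: "lower x 0 = 0" "lower x (Suc k) = var (x, k)"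
  by (simp_all add: lower_def)

lemma derivation_lower:
  assumes "derivation D" "\<And>n. D (var (x, n)) = lower x n * t"
  shows "D (lower x n) = lower x (n - 1) * t"
  by (cases n) (simp_all add: assms derivation_zero)

lemma derivation_dp_ideal:
  assumes D: "derivation D"
    and var: "\<And>x n. D (var (x, n)) = lower x n * t x"
    and t_add: "\<And>x y. t (x + y) \<approx> t x + t y"
    and t_smul: "\<And>b x. t (b \<odot> x) \<approx> const b * t x + D (const b) * var (x, Suc 0)"
    and p: "p \<in> dp_ideal smul"
  shows "D p \<in> dp_ideal smul"
proof -
  note der = derivation_add[OF D] derivation_mult[OF D] derivation_diff[OF D] derivation_sum[OF D]
    derivation_nat_multiple[OF D] derivation_zero[OF D]
  have smul: "D (var (b \<odot> x, m)) \<approx> D (const (b ^ m) * var (x, m))" for b x m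
  proof (cases m)
    case 0
    then show ?thesis by (simp add: der var derivation_const_one[OF D])
  next
    case (Suc k)
    have "D (var (b \<odot> x, m)) = var (b \<odot> x, k) * t (b \<odot> x)" by (simp add: Suc var)
    also have "\<dots> \<approx> (const (b ^ k) * var (x, k)) * (const b * t x + D (const b) * var (x, Suc 0))"
      by (intro cong_intros cong_gamma_smul t_smul)
    also have "\<dots> = const (b ^ m) * (var (x, k) * t x)
        + const (b ^ k) * D (const b) * (var (x, k) * var (x, Suc 0))"
      by (simp add: Suc const_mult algebra_simps)
    also have "\<dots> \<approx> const (b ^ m) * (var (x, k) * t x)
        + const (b ^ k) * D (const b) * nat_multiple ((k + Suc 0) choose k) (var (x, k + Suc 0))"
      by (intro cong_intros cong_gamma_mult)
    also have "\<dots> = const (b ^ m) * (lower x m * t x) + var (x, m) * D (const (b ^ m))"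
      unfolding Suc derivation_const_power[OF D]
      by (simp add: nat_multiple_mult_right algebra_simps)
    also have "\<dots> = D (const (b ^ m) * var (x, m))"
      by (simp add: der var)
    finally show ?thesis .
  qed
  have mult: "D (var (x, m) * var (x, n)) \<approx> D (nat_multiple ((m + n) choose m) (var (x, m + n)))" for x m n
  proof -
    consider "m = 0" | "n = 0" | k l where "m = Suc k" "n = Suc l"
      by (cases m; cases n) auto
    then show ?thesis
    proof cases
      case 1
      have "D (var (x, 0) * var (x, n)) = var (x, 0) * D (var (x, n))" by (simp add: der var)
      also have "\<dots> \<approx> const 1 * D (var (x, n))" by (intro cong_intros cong_gamma_0)
      finally show ?thesis by (simp add: 1)
    next
      case 2
      have "D (var (x, m) * var (x, 0)) = var (x, 0) * D (var (x, m))" by (simp add: der var)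
      also have "\<dots> \<approx> const 1 * D (var (x, m))" by (intro cong_intros cong_gamma_0)
      finally show ?thesis by (simp add: 2)
    next
      case 3
      have binom: "(m + n) choose m = (m + l choose m) + (n + k choose n)"
        using binomial_symmetric[of k "m + l"] by (simp add: 3 add.commute)
      have "D (var (x, m) * var (x, n)) = (var (x, m) * var (x, l)) * t x + (var (x, n) * var (x, k)) * t x"
        by (simp add: der var 3 algebra_simps)
      also have "\<dots> \<approx> nat_multiple (m + l choose m) (var (x, m + l)) * t x
          + nat_multiple (n + k choose n) (var (x, n + k)) * t x"
        by (intro cong_intros cong_gamma_mult)
      also have "\<dots> = D (nat_multiple ((m + n) choose m) (var (x, m + n)))"
        unfolding binom
        by (simp add: der var 3 nat_multiple_add nat_multiple_mult_left distrib_right add.commute)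
      finally show ?thesis .
    qed
  qed
  have add: "D (var (x + y, m)) \<approx> D (\<Sum>i\<le>m. var (x, i) * var (y, m - i))" for x y m
  proof (cases m)
    case 0
    then show ?thesis by (simp add: der var)
  next
    case (Suc k)
    have "D (var (x + y, m)) = var (x + y, k) * t (x + y)" by (simp add: Suc var)
    also have "\<dots> \<approx> (\<Sum>i\<le>k. var (x, i) * var (y, k - i)) * (t x + t y)"
      by (intro cong_intros cong_gamma_add t_add)
    also have "\<dots> = (\<Sum>i\<le>k. var (x, i) * (var (y, k - i) * t y)) + (\<Sum>i\<le>k. var (y, k - i) * (var (x, i) * t x))"
      unfolding distrib_left sum_distrib_right by (simp only: ac_simps)
    also have "(\<Sum>i\<le>k. var (x, i) * (var (y, k - i) * t y)) = (\<Sum>i\<le>m. var (x, i) * (lower y (m - i) * t y))"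
      by (simp add: Suc Suc_diff_le)
    also have "(\<Sum>i\<le>k. var (y, k - i) * (var (x, i) * t x)) = (\<Sum>i\<le>m. var (y, m - i) * (lower x i * t x))"
      unfolding Suc sum.atMost_Suc_shift by simp
    finally show ?thesis by (simp add: der var sum.distrib)
  qed
  have "dp_ideal smul \<subseteq> {p \<in> dp_ideal smul. D p \<in> dp_ideal smul}"
  proof (rule dp_ideal_minimal)
    have "dp_relations smul \<subseteq> dp_ideal smul"
      unfolding dp_ideal_def by (rule ring.genideal_self[OF cring.axioms(1)[OF cring_poly_ring]]) simp
    moreover have "D p \<in> dp_ideal smul" if "p \<in> dp_relations smul" for p
      using that smul mult add
      by (auto simp: dp_relations_def var[of _ 0] derivation_const_one[OF D] derivation_diff[OF D] cong_def nat_multiple_def)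
    ultimately show "dp_relations smul \<subseteq> {p \<in> dp_ideal smul. D p \<in> dp_ideal smul}"
      by blast
  qed (auto simp: der dp_ideal_add dp_ideal_mult dp_ideal_mult_right)
  with p show ?thesis by auto
qed

lemma derivation_cong_zeroI:
  assumes D: "derivation D" and "\<And>a. D (const a) \<approx> 0" "\<And>x n. D (var (x, n)) \<approx> 0"
  shows "D p \<approx> 0"
  using assms(2,3)
  by (induction p rule: mpoly_induct)
    (auto simp: cong_zero_iff derivation_add[OF D] derivation_mult[OF D] dp_ideal_add dp_ideal_mult)

end

section \<open>The bracket on the polynomial algebra\<close>

context lie_rinehart
begin

lemma lie_uminus_swap: "lie y x = - lie x y"
proof -
  have "lie x y + lie y x = lie (x + y) (x + y)"
    by (simp only: lie_add_left lie_add_right) (simp add: lie_self)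
  then show ?thesis by (simp add: lie_self eq_neg_iff_add_eq_0 add.commute)
qed

lemma lie_uminus_right: "lie x (- y) = - lie x y"
proof -
  have "lie x 0 = 0" using lie_add_right[of x 0 0] by simp
  then show ?thesis using lie_add_right[of x y "- y"] by (simp add: eq_neg_iff_add_eq_0 add.commute)
qed

lemma lie_lie_left: "lie (lie x y) z = lie x (lie y z) - lie y (lie x z)"
proof -
  have "lie y (lie z x) = - lie y (lie x z)"
    unfolding lie_uminus_swap[of z x] lie_uminus_right ..
  moreover have "lie z (lie x y) = - lie (lie x y) z" by (rule lie_uminus_swap)
  ultimately show ?thesis using lie_jacobi[of x y z] by (simp add: algebra_simps)
qed

lemma anchor_add_right: "\<rho> x (a + b) = \<rho> x a + \<rho> x b"
  and anchor_mult_right: "\<rho> x (a * b) = a * \<rho> x b + b * \<rho> x a"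
  using anchor_derivation[of x] by (simp_all add: k_derivation_def)

lemma anchor_structure: "\<rho> x (\<iota> c) = 0"
proof -
  have "\<rho> x 1 = 0" using anchor_mult_right[of x 1 1] by simp
  moreover have "\<rho> x (\<iota> c * 1) = \<iota> c * \<rho> x 1"
    using anchor_derivation[of x] unfolding k_derivation_def by blast
  ultimately show ?thesis by simp
qed

text \<open>\<open>ham x\<close> represents \<open>{\<gamma>\<^sub>1(x), -}\<close> and \<open>ham_scalar a\<close> represents \<open>{a, -}\<close>.
  Since \<open>{\<gamma>\<^sub>m(x), -} = \<gamma>\<^bsub>m-1\<^esub>(x) {\<gamma>\<^sub>1(x), -}\<close>, they determine the bracket.\<close>

definition ham :: "'l \<Rightarrow> ('l \<times> nat, 'a) mpoly \<Rightarrow> ('l \<times> nat, 'a) mpoly" where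
  "ham x = extend_der (\<lambda>a. const (\<rho> x a)) (\<lambda>(y, n). lower y n * var (lie x y, Suc 0))"

definition ham_scalar :: "'a \<Rightarrow> ('l \<times> nat, 'a) mpoly \<Rightarrow> ('l \<times> nat, 'a) mpoly" where
  "ham_scalar a = extend_der (\<lambda>b. 0) (\<lambda>(y, n). lower y n * - const (\<rho> y a))"

definition bracket :: "('l \<times> nat, 'a) mpoly \<Rightarrow> ('l \<times> nat, 'a) mpoly \<Rightarrow> ('l \<times> nat, 'a) mpoly" where
  "bracket p q = extend_der (\<lambda>a. ham_scalar a q) (\<lambda>(x, m). lower x m * ham x q) p"

lemma derivation_ham: "derivation (ham x)"
  and ham_const [simp]: "ham x (const a) = const (\<rho> x a)"
  and ham_var [simp]: "ham x (var (y, n)) = lower y n * var (lie x y, Suc 0)"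
  by (simp_all add: ham_def derivation_extend_der const_add const_mult anchor_add_right anchor_mult_right)

lemma derivation_ham_scalar: "derivation (ham_scalar a)"
  and ham_scalar_const [simp]: "ham_scalar a (const b) = 0"
  and ham_scalar_var [simp]: "ham_scalar a (var (y, n)) = lower y n * - const (\<rho> y a)"
  by (simp_all add: ham_scalar_def derivation_extend_der)

lemmas ham_simps = derivation_add[OF derivation_ham] derivation_diff[OF derivation_ham]
  derivation_mult[OF derivation_ham] derivation_uminus[OF derivation_ham] derivation_zero[OF derivation_ham]
  derivation_lower[OF derivation_ham ham_var]

lemmas ham_scalar_simps = derivation_add[OF derivation_ham_scalar] derivation_diff[OF derivation_ham_scalar]
  derivation_mult[OF derivation_ham_scalar] derivation_uminus[OF derivation_ham_scalar]
  derivation_zero[OF derivation_ham_scalar] derivation_lower[OF derivation_ham_scalar ham_scalar_var]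

lemma ham_scalar_add: "ham_scalar (a + b) q = ham_scalar a q + ham_scalar b q"
  by (rule derivation_eqI[where D = "ham_scalar (a + b)"])
    (auto intro: derivation_plus derivation_ham_scalar
      simp: split_paired_all anchor_add_right const_add algebra_simps)

lemma ham_scalar_mult: "ham_scalar (a * b) q = const a * ham_scalar b q + const b * ham_scalar a q"
  by (rule derivation_eqI[where D = "ham_scalar (a * b)"])
    (auto intro!: derivation_plus derivation_times derivation_ham_scalar
      simp: split_paired_all anchor_mult_right const_add const_mult algebra_simps)

lemma derivation_bracket_left: "derivation (\<lambda>p. bracket p q)"
  and bracket_const [simp]: "bracket (const a) q = ham_scalar a q"
  and bracket_var [simp]: "bracket (var (x, m)) q = lower x m * ham x q"
  by (simp_all add: bracket_def derivation_extend_der ham_scalar_add ham_scalar_mult)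

lemmas bracket_left_simps = derivation_add[OF derivation_bracket_left]
  derivation_diff[OF derivation_bracket_left] derivation_mult[OF derivation_bracket_left]
  derivation_uminus[OF derivation_bracket_left] derivation_zero[OF derivation_bracket_left]
  derivation_lower[OF derivation_bracket_left bracket_var]

lemma derivation_bracket_right: "derivation (bracket p)"
proof (induction p rule: mpoly_induct)
  case (const a)
  have "bracket (const a) = ham_scalar a" by (simp add: fun_eq_iff)
  then show ?case by (simp add: derivation_ham_scalar)
next
  case (var v)
  obtain x m where v: "v = (x, m)" by (cases v)
  have "bracket (var v) = (\<lambda>q. lower x m * ham x q)" by (simp add: fun_eq_iff v)
  then show ?case by (simp add: derivation_ham derivation_times)
next
  case (add p q)
  have "bracket (p + q) = (\<lambda>r. bracket p r + bracket q r)" by (simp add: fun_eq_iff bracket_left_simps)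
  then show ?case by (simp add: add derivation_plus)
next
  case (mult p q)
  have "bracket (p * q) = (\<lambda>r. p * bracket q r + q * bracket p r)"
    by (simp add: fun_eq_iff bracket_left_simps)
  then show ?case by (simp add: mult derivation_plus derivation_times)
qed

lemmas bracket_right_simps = derivation_add[OF derivation_bracket_right]
  derivation_diff[OF derivation_bracket_right] derivation_mult[OF derivation_bracket_right]
  derivation_uminus[OF derivation_bracket_right] derivation_zero[OF derivation_bracket_right]

lemma cong_gamma_1_lie_swap: "var (lie y x, Suc 0) \<approx> - var (lie x y, Suc 0)"
  unfolding lie_uminus_swap[of y x] by (rule cong_gamma_1_uminus)

lemma bracket_antisym: "bracket p q + bracket q p \<approx> 0"
proof -
  have var: "bracket (var v) q + bracket q (var v) \<approx> 0" for v q
  proof -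
    obtain x m where v: "v = (x, m)" by (cases v)
    show ?thesis
      unfolding v
    proof (rule derivation_cong_zeroI[where D = "\<lambda>q. bracket (var (x, m)) q + bracket q (var (x, m))"])
      show "derivation (\<lambda>q. bracket (var (x, m)) q + bracket q (var (x, m)))"
        by (intro derivation_plus derivation_bracket_left derivation_bracket_right)
      show "bracket (var (x, m)) (const a) + bracket (const a) (var (x, m)) \<approx> 0" for a
        by simp
      show "bracket (var (x, m)) (var (y, n)) + bracket (var (y, n)) (var (x, m)) \<approx> 0" for y n
      proof -
        have "lower x m * (lower y n * var (lie x y, Suc 0)) + lower y n * (lower x m * var (lie y x, Suc 0))
          \<approx> lower x m * (lower y n * var (lie x y, Suc 0)) + lower y n * (lower x m * - var (lie x y, Suc 0))"
          by (intro cong_intros cong_gamma_1_lie_swap)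
        then show ?thesis by (simp add: mult.left_commute)
      qed
    qed
  qed
  show ?thesis
  proof (rule derivation_cong_zeroI[where D = "\<lambda>q. bracket p q + bracket q p"])
    show "derivation (\<lambda>q. bracket p q + bracket q p)"
      by (intro derivation_plus derivation_bracket_left derivation_bracket_right)
    show "bracket p (const a) + bracket (const a) p \<approx> 0" for a
    proof (rule derivation_cong_zeroI[where D = "\<lambda>p. bracket p (const a) + bracket (const a) p"])
      show "derivation (\<lambda>p. bracket p (const a) + bracket (const a) p)"
        by (intro derivation_plus derivation_bracket_left derivation_bracket_right)
    qed simp_all
    show "bracket p (var (x, n)) + bracket (var (x, n)) p \<approx> 0" for x n
      using var[of "(x, n)" p] by (simp add: add.commute)
  qed
qed

lemma bracket_self: "bracket p p \<approx> 0"
proof (induction p rule: mpoly_induct)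
  case (var v)
  obtain x m where v: "v = (x, m)" by (cases v)
  have "lower x m * (lower x m * var (0, Suc 0)) \<approx> lower x m * (lower x m * 0)"
    by (intro cong_intros cong_gamma_1_zero)
  then show ?case by (simp add: v lie_self)
next
  case (add p q)
  have "bracket (p + q) (p + q) = bracket p p + bracket q q + (bracket p q + bracket q p)"
    by (simp add: bracket_left_simps bracket_right_simps algebra_simps)
  also have "\<dots> \<approx> 0 + 0 + 0" by (intro cong_add add bracket_antisym)
  finally show ?case by simp
next
  case (mult p q)
  have "bracket (p * q) (p * q) = p * p * bracket q q + q * q * bracket p p
      + p * q * (bracket p q + bracket q p)"
    by (simp add: bracket_left_simps bracket_right_simps algebra_simps)
  also have "\<dots> \<approx> p * p * 0 + q * q * 0 + p * q * 0"
    by (intro cong_intros mult bracket_antisym)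
  finally show ?case by simp
qed simp

lemma ham_dp_ideal: "p \<in> dp_ideal smul \<Longrightarrow> ham x p \<in> dp_ideal smul"
proof (rule derivation_dp_ideal[OF derivation_ham ham_var])
  fix y z show "var (lie x (y + z), Suc 0) \<approx> var (lie x y, Suc 0) + var (lie x z, Suc 0)"
    unfolding lie_add_right by (rule cong_gamma_1_add)
next
  fix b y
  have "var (lie x (b \<odot> y), Suc 0) \<approx> var (b \<odot> lie x y, Suc 0) + var (\<rho> x b \<odot> y, Suc 0)"
    unfolding lie_smul by (rule cong_gamma_1_add)
  also have "\<dots> \<approx> const b * var (lie x y, Suc 0) + const (\<rho> x b) * var (y, Suc 0)"
    by (intro cong_intros cong_gamma_1_smul)
  finally show "var (lie x (b \<odot> y), Suc 0) \<approx> const b * var (lie x y, Suc 0) + ham x (const b) * var (y, Suc 0)"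
    by simp
qed

lemma ham_scalar_dp_ideal: "p \<in> dp_ideal smul \<Longrightarrow> ham_scalar a p \<in> dp_ideal smul"
  by (rule derivation_dp_ideal[OF derivation_ham_scalar ham_scalar_var])
    (simp_all add: anchor_add anchor_smul const_add const_mult)

lemma bracket_dp_ideal_right: "q \<in> dp_ideal smul \<Longrightarrow> bracket p q \<in> dp_ideal smul"
  by (induction p rule: mpoly_induct)
    (simp_all add: split_paired_all bracket_left_simps dp_ideal_add dp_ideal_mult
      ham_dp_ideal ham_scalar_dp_ideal)

lemma bracket_dp_ideal_left: "p \<in> dp_ideal smul \<Longrightarrow> bracket p q \<in> dp_ideal smul"
  using dp_ideal_diff[of "bracket p q + bracket q p" smul "bracket q p"] bracket_antisym[of p q]
    bracket_dp_ideal_right[of p q] by (simp add: cong_zero_iff)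

lemma bracket_cong:
  assumes "p \<approx> p'" "q \<approx> q'" shows "bracket p q \<approx> bracket p' q'"
proof -
  have "bracket p q - bracket p' q' = bracket (p - p') q + bracket p' (q - q')"
    by (simp add: bracket_left_simps bracket_right_simps)
  then show ?thesis
    using assms by (simp add: cong_def dp_ideal_add bracket_dp_ideal_left bracket_dp_ideal_right)
qed

lemma ham_commutator: "ham x (ham y r) - ham y (ham x r) - ham (lie x y) r \<approx> 0"
proof (rule derivation_cong_zeroI[where D = "\<lambda>r. ham x (ham y r) - ham y (ham x r) - ham (lie x y) r"])
  show "derivation (\<lambda>r. ham x (ham y r) - ham y (ham x r) - ham (lie x y) r)"
    by (intro derivation_minus derivation_commutator derivation_ham)
  show "ham x (ham y (const a)) - ham y (ham x (const a)) - ham (lie x y) (const a) \<approx> 0" for a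
    by (simp add: anchor_lie const_diff)
  show "ham x (ham y (var (z, n))) - ham y (ham x (var (z, n))) - ham (lie x y) (var (z, n)) \<approx> 0" for z n
  proof -
    let ?v = "\<lambda>u. var (u, Suc 0)" and ?o = "\<lambda>u. var (u, 0)"
    have "ham x (ham y (var (z, n))) - ham y (ham x (var (z, n))) - ham (lie x y) (var (z, n))
      = lower z n * (?o (lie y z) * ?v (lie x (lie y z)) - ?o (lie x z) * ?v (lie y (lie x z))
        - ?v (lie (lie x y) z))"
      by (simp add: ham_simps algebra_simps)
    also have "\<dots> \<approx> lower z n * (const 1 * ?v (lie x (lie y z)) - const 1 * ?v (lie y (lie x z))
        - (?v (lie x (lie y z)) - ?v (lie y (lie x z))))"
      unfolding lie_lie_left by (intro cong_intros cong_gamma_0 cong_gamma_1_diff)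
    finally show ?thesis by simp
  qed
qed

lemma ham_scalar_ham_commutator: "ham_scalar a (ham y r) - ham y (ham_scalar a r) + ham_scalar (\<rho> y a) r \<approx> 0"
proof (rule derivation_cong_zeroI[where
      D = "\<lambda>r. ham_scalar a (ham y r) - ham y (ham_scalar a r) + ham_scalar (\<rho> y a) r"])
  show "derivation (\<lambda>r. ham_scalar a (ham y r) - ham y (ham_scalar a r) + ham_scalar (\<rho> y a) r)"
    by (intro derivation_plus derivation_commutator derivation_ham derivation_ham_scalar)
  show "ham_scalar a (ham y (const b)) - ham y (ham_scalar a (const b)) + ham_scalar (\<rho> y a) (const b) \<approx> 0" for b
    by (simp add: ham_simps)
  show "ham_scalar a (ham y (var (z, n))) - ham y (ham_scalar a (var (z, n)))
      + ham_scalar (\<rho> y a) (var (z, n)) \<approx> 0" for z n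
  proof -
    have "ham_scalar a (ham y (var (z, n))) - ham y (ham_scalar a (var (z, n)))
        + ham_scalar (\<rho> y a) (var (z, n))
      = lower z n * (var (lie y z, 0) * - const (\<rho> (lie y z) a) + const (\<rho> (lie y z) a))"
      by (simp add: ham_simps ham_scalar_simps anchor_lie const_diff algebra_simps)
    also have "\<dots> \<approx> lower z n * (const 1 * - const (\<rho> (lie y z) a) + const (\<rho> (lie y z) a))"
      by (intro cong_intros cong_gamma_0)
    finally show ?thesis by simp
  qed
qed

lemma ham_scalar_commute: "ham_scalar a (ham_scalar b r) = ham_scalar b (ham_scalar a r)"
proof -
  have "ham_scalar a (ham_scalar b r) - ham_scalar b (ham_scalar a r) = 0"
    by (rule derivation_eqI[where E = "\<lambda>r. 0"])
      (auto intro: derivation_commutator derivation_ham_scalar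
        simp: split_paired_all ham_scalar_simps derivation_def algebra_simps)
  then show ?thesis by simp
qed

definition jacobiator where
  "jacobiator p q r = bracket p (bracket q r) - bracket q (bracket p r) - bracket (bracket p q) r"

lemma jacobiator_antisym: "jacobiator p q r + jacobiator q p r \<approx> 0"
proof -
  have "jacobiator p q r + jacobiator q p r = - bracket (bracket p q + bracket q p) r"
    by (simp add: jacobiator_def bracket_left_simps)
  then show ?thesis
    using bracket_antisym[of p q]
    by (simp add: cong_zero_iff dp_ideal_uminus bracket_dp_ideal_left)
qed

lemma jacobiator_zero_swap: "jacobiator q p r \<approx> 0 \<Longrightarrow> jacobiator p q r \<approx> 0"
  using dp_ideal_diff[of "jacobiator p q r + jacobiator q p r" smul "jacobiator q p r"]
    jacobiator_antisym[of p q r] by (simp add: cong_zero_iff)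

lemma jacobiator_const_const: "jacobiator (const a) (const b) r \<approx> 0"
  by (simp add: jacobiator_def bracket_left_simps ham_scalar_commute[of a b])

lemma jacobiator_const_var: "jacobiator (const a) (var (y, n)) r \<approx> 0"
proof -
  have "jacobiator (const a) (var (y, n)) r = lower y n *
      (ham_scalar a (ham y r) - ham y (ham_scalar a r) + ham_scalar (\<rho> y a) r)"
    by (simp add: jacobiator_def bracket_left_simps ham_scalar_simps algebra_simps)
  also have "\<dots> \<approx> lower y n * 0" by (intro cong_intros ham_scalar_ham_commutator)
  finally show ?thesis by simp
qed

lemma jacobiator_var_var: "jacobiator (var (x, m)) (var (y, n)) r \<approx> 0"
proof -
  let ?X = "lower x m" and ?Y = "lower y n" and ?v = "\<lambda>x y. var (lie x y, Suc 0)"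
  have "jacobiator (var (x, m)) (var (y, n)) r
    = ?X * ?Y * (ham x (ham y r) - ham y (ham x r) - ham (lie x y) r)
      + ?X * ?Y * ham (lie x y) r * (const 1 - var (lie x y, 0))
      - ?Y * lower x (m - 1) * ham x r * (?v y x + ?v x y)"
    by (simp add: jacobiator_def bracket_left_simps ham_simps algebra_simps)
  also have "\<dots> \<approx> ?X * ?Y * 0 + ?X * ?Y * ham (lie x y) r * (const 1 - const 1)
      - ?Y * lower x (m - 1) * ham x r * (- ?v x y + ?v x y)"
    by (intro cong_intros ham_commutator cong_gamma_0 cong_gamma_1_lie_swap)
  finally show ?thesis by simp
qed

lemma jacobiator_add_left: "jacobiator (p + p') q r = jacobiator p q r + jacobiator p' q r"
  by (simp add: jacobiator_def bracket_left_simps bracket_right_simps)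

lemma jacobiator_mult_left: "jacobiator (p * p') q r \<approx> p * jacobiator p' q r + p' * jacobiator p q r"
proof -
  have "jacobiator (p * p') q r - (p * jacobiator p' q r + p' * jacobiator p q r)
    = - ((bracket p q + bracket q p) * bracket p' r + (bracket p' q + bracket q p') * bracket p r)"
    by (simp add: jacobiator_def bracket_left_simps bracket_right_simps algebra_simps)
  also have "\<dots> \<approx> - (0 * bracket p' r + 0 * bracket p r)"
    by (intro cong_intros bracket_antisym)
  finally show ?thesis by (simp add: cong_def)
qed

lemma jacobiator_zero_left:
  assumes "\<And>a. jacobiator (const a) q r \<approx> 0" "\<And>x m. jacobiator (var (x, m)) q r \<approx> 0"
  shows "jacobiator p q r \<approx> 0"
proof (induction p rule: mpoly_induct)
  case (add p p')
  have "jacobiator p q r + jacobiator p' q r \<approx> 0 + 0" by (intro cong_add add)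
  then show ?case by (simp add: jacobiator_add_left)
next
  case (mult p p')
  have "p * jacobiator p' q r + p' * jacobiator p q r \<approx> p * 0 + p' * 0"
    by (intro cong_intros mult)
  then show ?case using cong_trans[OF jacobiator_mult_left] by simp
qed (simp_all add: split_paired_all assms)

lemma jacobiator_zero: "jacobiator p q r \<approx> 0"
  by (rule jacobiator_zero_left; rule jacobiator_zero_swap; rule jacobiator_zero_left)
    (simp_all add: jacobiator_const_const jacobiator_const_var jacobiator_var_var
      jacobiator_zero_swap[OF jacobiator_const_var])

lemma bracket_jacobi: "bracket p (bracket q r) + bracket q (bracket r p) + bracket r (bracket p q) \<approx> 0"
proof -
  have "bracket p (bracket q r) + bracket q (bracket r p) + bracket r (bracket p q)
    = jacobiator p q r + bracket q (bracket p r + bracket r p)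
      + (bracket r (bracket p q) + bracket (bracket p q) r)"
    by (simp add: jacobiator_def bracket_right_simps algebra_simps)
  also have "\<dots> \<approx> 0 + bracket q 0 + 0"
    by (intro cong_add bracket_cong cong_refl jacobiator_zero bracket_antisym)
  finally show ?thesis by (simp add: bracket_right_simps)
qed

lemma lower_homogeneous: "lower x m \<in> homogeneous (int m - 1)"
proof (cases m)
  case (Suc k)
  then show ?thesis using homogeneous_var[of "(x, k)"] by simp
qed simp

lemma ham_homogeneous: "p \<in> homogeneous d \<Longrightarrow> ham x p \<in> homogeneous d"
proof -
  have "ham x (var (y, n)) \<in> homogeneous (int n)" for y n
    using homogeneous_mult[OF lower_homogeneous[of y n] homogeneous_var[of "(lie x y, Suc 0)"]] by simp
  then show "p \<in> homogeneous d \<Longrightarrow> ?thesis"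
    using derivation_homogeneous[OF derivation_ham, of x 0 p d]
    by (simp add: split_paired_all homogeneous_const)
qed

lemma ham_scalar_homogeneous: "p \<in> homogeneous d \<Longrightarrow> ham_scalar a p \<in> homogeneous (d - 1)"
proof -
  have "ham_scalar a (var (y, n)) \<in> homogeneous (int n - 1)" for y n
    using homogeneous_mult[OF lower_homogeneous[of y n] homogeneous_const[of "- \<rho> y a"]]
    by (simp add: const_uminus)
  then show "p \<in> homogeneous d \<Longrightarrow> ?thesis"
    using derivation_homogeneous[OF derivation_ham_scalar, of a "- 1" p d]
    by (simp add: split_paired_all)
qed

lemma bracket_homogeneous:
  assumes "p \<in> homogeneous d" "q \<in> homogeneous e"
  shows "bracket p q \<in> homogeneous (d + e - 1)"
proof -
  have "lower x m * ham x q \<in> homogeneous (int m + (e - 1))" for x m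
    using homogeneous_mult[OF lower_homogeneous[of x m] ham_homogeneous[OF assms(2)]]
    by (simp add: algebra_simps)
  then show ?thesis
    using derivation_homogeneous[OF derivation_bracket_left, of q "e - 1" p d]
      ham_scalar_homogeneous[OF assms(2)] assms(1)
    by (simp add: split_paired_all algebra_simps)
qed

end

section \<open>The bracket on the divided power algebra\<close>

lemma dp_class_eq_iff: "dp_class smul p = dp_class smul q \<longleftrightarrow> p - q \<in> dp_ideal smul"
proof -
  interpret ideal "dp_ideal smul" poly_ring by (rule ideal_dp_ideal)
  have mem: "r \<in> dp_class smul p \<longleftrightarrow> r - p \<in> dp_ideal smul" for p r
  proof -
    have "r = h + p \<longleftrightarrow> h = r - p" for h by (auto simp: algebra_simps)
    then show ?thesis by (auto simp: dp_class_def a_r_coset_def')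
  qed
  show ?thesis
  proof
    assume "dp_class smul p = dp_class smul q"
    then show "p - q \<in> dp_ideal smul" using mem[of p p] by (simp add: mem)
  next
    assume pq: "p - q \<in> dp_ideal smul"
    have "r - p \<in> dp_ideal smul \<longleftrightarrow> r - q \<in> dp_ideal smul" for r
      using dp_ideal_add[of "r - p" smul "p - q"] dp_ideal_diff[of "r - q" smul "p - q"] pq by auto
    then show "dp_class smul p = dp_class smul q" by (simp add: set_eq_iff mem)
  qed
qed

lemma cring_dp_algebra: "cring (dp_algebra smul)"
  unfolding dp_algebra_def by (rule ideal.quotient_is_cring[OF ideal_dp_ideal cring_poly_ring])

lemma dp_class_ring_hom: "dp_class smul \<in> ring_hom poly_ring (dp_algebra smul)"
  using ideal.rcos_ring_hom[OF ideal_dp_ideal, of smul] unfolding dp_algebra_def dp_class_def .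

lemma dp_class_add: "dp_class smul (p + q) = dp_class smul p \<oplus>\<^bsub>dp_algebra smul\<^esub> dp_class smul q"
  and dp_class_mult: "dp_class smul (p * q) = dp_class smul p \<otimes>\<^bsub>dp_algebra smul\<^esub> dp_class smul q"
  and dp_class_one: "dp_class smul (const 1) = \<one>\<^bsub>dp_algebra smul\<^esub>"
  and dp_class_closed: "dp_class smul p \<in> carrier (dp_algebra smul)"
  using ring_hom_add[OF dp_class_ring_hom, of p q smul] ring_hom_mult[OF dp_class_ring_hom, of p q smul]
    ring_hom_one[OF dp_class_ring_hom, of smul] ring_hom_closed[OF dp_class_ring_hom, of p smul]
  by simp_all

lemma dp_class_zero: "dp_class smul 0 = \<zero>\<^bsub>dp_algebra smul\<^esub>"
proof -
  interpret R: cring "dp_algebra smul" by (rule cring_dp_algebra)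
  have "dp_class smul 0 = dp_class smul 0 \<oplus>\<^bsub>dp_algebra smul\<^esub> dp_class smul 0"
    using dp_class_add[of smul 0 0] by simp
  then show ?thesis using R.add.r_cancel_one' dp_class_closed by metis
qed

lemma dp_class_surj:
  assumes "r \<in> carrier (dp_algebra smul)" obtains p where "r = dp_class smul p"
  using assms by (auto simp: dp_algebra_def FactRing_def A_RCOSETS_def' dp_class_def)

context lie_rinehart
begin

definition dp_bracket where
  "dp_bracket r s = dp_class smul (bracket (SOME p. dp_class smul p = r) (SOME q. dp_class smul q = s))"

lemma dp_bracket_class: "dp_bracket (dp_class smul p) (dp_class smul q) = dp_class smul (bracket p q)"
proof -
  have "(SOME p'. dp_class smul p' = dp_class smul p) \<approx> p" for p
    unfolding cong_def dp_class_eq_iff[symmetric] by (rule someI) simp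
  then show ?thesis
    using bracket_cong by (simp add: dp_bracket_def dp_class_eq_iff cong_def)
qed

lemma poisson_structure_dp_bracket:
  "poisson_structure (dp_algebra smul) (\<lambda>c. dp_scalar smul (\<iota> c)) dp_bracket"
proof (intro poisson_structure.intro cring_dp_algebra poisson_structure_axioms.intro)
  have zero: "dp_class smul p = \<zero>\<^bsub>dp_algebra smul\<^esub>" if "p \<approx> 0" for p
    using that by (simp add: cong_def dp_class_eq_iff flip: dp_class_zero)
  fix r s t
  assume r: "r \<in> carrier (dp_algebra smul)"
  then obtain p where p: "r = dp_class smul p" by (rule dp_class_surj)
  show "dp_bracket r r = \<zero>\<^bsub>dp_algebra smul\<^esub>"
    unfolding p dp_bracket_class by (rule zero[OF bracket_self])
  assume s: "s \<in> carrier (dp_algebra smul)"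
  then obtain q where q: "s = dp_class smul q" by (rule dp_class_surj)
  show "dp_bracket r s \<in> carrier (dp_algebra smul)"
    unfolding p q dp_bracket_class by (rule dp_class_closed)
  show "dp_bracket (dp_scalar smul (\<iota> c) \<otimes>\<^bsub>dp_algebra smul\<^esub> r) s
      = dp_scalar smul (\<iota> c) \<otimes>\<^bsub>dp_algebra smul\<^esub> dp_bracket r s"
    and "dp_bracket r (dp_scalar smul (\<iota> c) \<otimes>\<^bsub>dp_algebra smul\<^esub> s)
      = dp_scalar smul (\<iota> c) \<otimes>\<^bsub>dp_algebra smul\<^esub> dp_bracket r s" for c
  proof -
    have left: "bracket (const (\<iota> c)) u = 0" for u
      unfolding bracket_const
      by (rule derivation_eqI[where E = "\<lambda>r. 0"])
        (auto simp: split_paired_all anchor_structure derivation_ham_scalar derivation_def ham_scalar_simps)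
    then have right: "bracket u (const (\<iota> c)) \<approx> 0" for u
      using bracket_antisym[of "const (\<iota> c)" u] by (simp only: add_0_left)
    show "dp_bracket (dp_scalar smul (\<iota> c) \<otimes>\<^bsub>dp_algebra smul\<^esub> r) s
        = dp_scalar smul (\<iota> c) \<otimes>\<^bsub>dp_algebra smul\<^esub> dp_bracket r s"
      using left
      by (simp add: p q dp_scalar_def dp_bracket_class bracket_left_simps del: bracket_const
          flip: dp_class_mult)
    show "dp_bracket r (dp_scalar smul (\<iota> c) \<otimes>\<^bsub>dp_algebra smul\<^esub> s)
        = dp_scalar smul (\<iota> c) \<otimes>\<^bsub>dp_algebra smul\<^esub> dp_bracket r s"
      using right[of p]
      by (simp add: p q dp_scalar_def dp_bracket_class bracket_right_simps dp_class_eq_iff cong_def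
          dp_ideal_mult flip: dp_class_mult)
  qed
  assume t: "t \<in> carrier (dp_algebra smul)"
  then obtain u where u: "t = dp_class smul u" by (rule dp_class_surj)
  show "dp_bracket (r \<oplus>\<^bsub>dp_algebra smul\<^esub> s) t = dp_bracket r t \<oplus>\<^bsub>dp_algebra smul\<^esub> dp_bracket s t"
    and "dp_bracket r (s \<oplus>\<^bsub>dp_algebra smul\<^esub> t) = dp_bracket r s \<oplus>\<^bsub>dp_algebra smul\<^esub> dp_bracket r t"
    and "dp_bracket (r \<otimes>\<^bsub>dp_algebra smul\<^esub> s) t = r \<otimes>\<^bsub>dp_algebra smul\<^esub> dp_bracket s t
      \<oplus>\<^bsub>dp_algebra smul\<^esub> s \<otimes>\<^bsub>dp_algebra smul\<^esub> dp_bracket r t"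
    and "dp_bracket r (s \<otimes>\<^bsub>dp_algebra smul\<^esub> t) = s \<otimes>\<^bsub>dp_algebra smul\<^esub> dp_bracket r t
      \<oplus>\<^bsub>dp_algebra smul\<^esub> t \<otimes>\<^bsub>dp_algebra smul\<^esub> dp_bracket r s"
    by (simp_all add: p q u dp_bracket_class bracket_left_simps bracket_right_simps
        flip: dp_class_add dp_class_mult)
  show "dp_bracket r (dp_bracket s t) \<oplus>\<^bsub>dp_algebra smul\<^esub> dp_bracket s (dp_bracket t r)
      \<oplus>\<^bsub>dp_algebra smul\<^esub> dp_bracket t (dp_bracket r s) = \<zero>\<^bsub>dp_algebra smul\<^esub>"
    unfolding p q u dp_bracket_class dp_class_add[symmetric] by (rule zero[OF bracket_jacobi])
next
  fix c d
  show "dp_scalar smul (\<iota> c) \<in> carrier (dp_algebra smul)"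
    by (simp add: dp_scalar_def dp_class_closed)
  show "dp_scalar smul (\<iota> (c + d))
      = dp_scalar smul (\<iota> c) \<oplus>\<^bsub>dp_algebra smul\<^esub> dp_scalar smul (\<iota> d)"
    and "dp_scalar smul (\<iota> (c * d))
      = dp_scalar smul (\<iota> c) \<otimes>\<^bsub>dp_algebra smul\<^esub> dp_scalar smul (\<iota> d)"
    by (simp_all add: dp_scalar_def structure_add structure_mult const_add const_mult
        dp_class_add dp_class_mult)
  show "dp_scalar smul (\<iota> 1) = \<one>\<^bsub>dp_algebra smul\<^esub>"
    by (simp add: dp_scalar_def structure_one dp_class_one)
qed

lemma dp_poisson_dp_bracket: "dp_poisson \<iota> smul lie \<rho> dp_bracket"
  unfolding dp_poisson_def
proof (intro conjI allI impI poisson_structure_dp_bracket)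
  show "dp_bracket (dp_scalar smul a) (dp_scalar smul b) = \<zero>\<^bsub>dp_algebra smul\<^esub>" for a b
    by (simp add: dp_scalar_def dp_bracket_class dp_class_zero)
next
  fix m :: nat and x assume "1 \<le> m"
  then obtain k where m: "m = Suc k" by (cases m) auto
  show "dp_bracket (dp_gamma smul m x) (dp_scalar smul a)
      = dp_scalar smul (\<rho> x a) \<otimes>\<^bsub>dp_algebra smul\<^esub> dp_gamma smul (m - 1) x" for a
    by (simp add: m dp_scalar_def dp_gamma_def dp_bracket_class mult.commute flip: dp_class_mult)
  fix n :: nat and y assume "1 \<le> n"
  then obtain l where n: "n = Suc l" by (cases n) auto
  show "dp_bracket (dp_gamma smul m x) (dp_gamma smul n y)
      = dp_gamma smul (m - 1) x \<otimes>\<^bsub>dp_algebra smul\<^esub> dp_gamma smul (n - 1) y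
        \<otimes>\<^bsub>dp_algebra smul\<^esub> dp_gamma smul 1 (lie x y)"
    by (simp add: m n dp_gamma_def dp_bracket_class mult.assoc flip: dp_class_mult)
qed

lemma dp_gamma_0: "dp_gamma smul 0 x = \<one>\<^bsub>dp_algebra smul\<^esub>"
  using cong_gamma_0[of x] by (simp add: dp_gamma_def cong_def dp_class_eq_iff flip: dp_class_one)

end

lemma (in poisson_structure) pb_antisym:
  assumes "r \<in> carrier R" "s \<in> carrier R" shows "pb r s = \<ominus> pb s r"
proof -
  have "pb (r \<oplus> s) (r \<oplus> s) = pb r s \<oplus> pb s r"
    using assms by (simp only: pb_add_left pb_add_right a_closed) (simp add: pb_closed pb_self a_comm)
  then show ?thesis
    using assms by (simp add: pb_self pb_closed minus_equality)
qed

lemma (in poisson_structure) pb_one_left: "s \<in> carrier R \<Longrightarrow> pb \<one> s = \<zero>"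
proof -
  assume s: "s \<in> carrier R"
  have "pb (\<one> \<otimes> \<one>) s = \<one> \<otimes> pb \<one> s \<oplus> \<one> \<otimes> pb \<one> s" by (rule pb_leibniz_left) (simp_all add: s)
  then have "pb \<one> s = pb \<one> s \<oplus> pb \<one> s" using s by (simp add: pb_closed)
  then show ?thesis using s by (simp add: pb_closed)
qed

lemma (in poisson_structure) pb_one_right: "s \<in> carrier R \<Longrightarrow> pb s \<one> = \<zero>"
  using pb_antisym[of s \<one>] by (simp add: pb_one_left)

context lie_rinehart
begin

lemma dp_poisson_unique:
  assumes pb: "dp_poisson \<iota> smul lie \<rho> pb" and pb': "dp_poisson \<iota> smul lie \<rho> pb'"
  shows "pb' (dp_class smul p) (dp_class smul q) = pb (dp_class smul p) (dp_class smul q)"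
proof -
  interpret P: poisson_structure "dp_algebra smul" "\<lambda>c. dp_scalar smul (\<iota> c)" pb
    using pb by (simp add: dp_poisson_def)
  interpret P': poisson_structure "dp_algebra smul" "\<lambda>c. dp_scalar smul (\<iota> c)" pb'
    using pb' by (simp add: dp_poisson_def)
  have scalar_scalar: "pb' (dp_scalar smul a) (dp_scalar smul b) = pb (dp_scalar smul a) (dp_scalar smul b)" for a b
    using pb pb' by (simp add: dp_poisson_def)
  have closed: "dp_scalar smul a \<in> carrier (dp_algebra smul)" "dp_gamma smul n x \<in> carrier (dp_algebra smul)" for a n x
    by (simp_all add: dp_scalar_def dp_gamma_def dp_class_closed)
  have gamma_scalar: "pb' (dp_gamma smul m x) (dp_scalar smul a) = pb (dp_gamma smul m x) (dp_scalar smul a)" for m x a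
    using pb pb' closed
    by (cases m) (simp_all add: dp_poisson_def dp_gamma_0 P.pb_one_left P'.pb_one_left)
  have scalar_gamma: "pb' (dp_scalar smul a) (dp_gamma smul m x) = pb (dp_scalar smul a) (dp_gamma smul m x)" for m x a
    using gamma_scalar P.pb_antisym P'.pb_antisym closed by metis
  have gamma_gamma: "pb' (dp_gamma smul m x) (dp_gamma smul n y) = pb (dp_gamma smul m x) (dp_gamma smul n y)" for m x n y
    using pb pb' closed
    by (cases m; cases n) (simp_all add: dp_poisson_def dp_gamma_0 P.pb_one_left P'.pb_one_left
        P.pb_one_right P'.pb_one_right)
  note right = dp_class_add dp_class_mult P.pb_add_right P'.pb_add_right P.pb_leibniz_right P'.pb_leibniz_right
    dp_class_closed
  note left = dp_class_add dp_class_mult P.pb_add_left P'.pb_add_left P.pb_leibniz_left P'.pb_leibniz_left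
    dp_class_closed
  have "pb' (dp_scalar smul a) (dp_class smul q) = pb (dp_scalar smul a) (dp_class smul q)" for a
    by (induction q rule: mpoly_induct)
      (simp_all add: scalar_scalar scalar_gamma right closed split_paired_all
        flip: dp_scalar_def dp_gamma_def)
  moreover have "pb' (dp_gamma smul m x) (dp_class smul q) = pb (dp_gamma smul m x) (dp_class smul q)" for m x
    by (induction q rule: mpoly_induct)
      (simp_all add: gamma_scalar gamma_gamma right closed split_paired_all
        flip: dp_scalar_def dp_gamma_def)
  ultimately show ?thesis
    by (induction p rule: mpoly_induct)
      (simp_all add: left split_paired_all flip: dp_scalar_def dp_gamma_def)
qed

lemma dp_bracket_graded: "graded_degree_minus_one (dp_component smul) dp_bracket"
  using bracket_homogeneous
  by (auto simp: graded_degree_minus_one_def dp_component_def dp_bracket_class)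

end

theorem proposition4p1:
  fixes \<iota> :: "'k::{comm_ring, comm_monoid_mult} \<Rightarrow> 'a::{comm_ring, comm_monoid_mult}"
    and smul :: "'a \<Rightarrow> 'l::ab_group_add \<Rightarrow> 'l"
    and lie :: "'l \<Rightarrow> 'l \<Rightarrow> 'l"
    and \<rho> :: "'l \<Rightarrow> 'a \<Rightarrow> 'a"
  assumes "lie_rinehart \<iota> smul lie \<rho>"
  shows "\<exists>pb. dp_poisson \<iota> smul lie \<rho> pb \<and>
    (\<forall>pb'. dp_poisson \<iota> smul lie \<rho> pb' \<longrightarrow>
       (\<forall>r \<in> carrier (dp_algebra smul). \<forall>s \<in> carrier (dp_algebra smul). pb' r s = pb r s)) \<and>
    graded_degree_minus_one (dp_component smul) pb"
proof -
  interpret lie_rinehart \<iota> smul lie \<rho> by (rule assms)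
  show ?thesis
    using dp_poisson_dp_bracket dp_bracket_graded dp_poisson_unique[OF dp_poisson_dp_bracket]
    by (metis dp_class_surj)
qed

end
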